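(* For every finite group $G$, the intersection complex $K(G)$ and the order complex of the poset of proper non-trivial subgroups of $G$ (ordered by inclusion) are homotopy equivalent.
   Context: For a group $G$, the intersection complex $K(G)$ is the abstract simplicial complex whose vertices are the proper non-trivial subgroups of $G$ and whose (non-empty) faces are the sets of proper subgroups $\{H_1,\dots,H_m\}$ of $G$ with $H_1\cap\dots\cap H_m\neq 1$. The order complex of a poset is the simplicial complex whose simplices are the finite chains of the poset. Homotopy equivalence of simplicial complexes refers to their geometric realizations. *)

theory Defs
  imports "HOL-Analysis.Analysis" "HOL-Algebra.Group"
begin

section \<open>Abstract simplicial complexes and their geometric realization\<close>

text \<open>An abstract simplicial complex is given by its set of (non-empty, finite) faces; a vertex is a
  point \<open>v\<close> such that \<open>{v}\<close> is a face.\<close>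

definition abstract_simplicial_complex :: "'v set set \<Rightarrow> bool" where
  "abstract_simplicial_complex K \<longleftrightarrow>
     (\<forall>s\<in>K. finite s \<and> s \<noteq> {}) \<and> (\<forall>s\<in>K. \<forall>t. t \<subseteq> s \<longrightarrow> t \<noteq> {} \<longrightarrow> t \<in> K)"

definition supp :: "('v \<Rightarrow> real) \<Rightarrow> 'v set" where
  "supp x = {v. x v \<noteq> 0}"

text \<open>Points of the realization are given by their barycentric coordinates.\<close>

definition realization_points :: "'v set set \<Rightarrow> ('v \<Rightarrow> real) set" where
  "realization_points K = {x. (\<forall>v. 0 \<le> x v) \<and> supp x \<in> K \<and> (\<Sum>v\<in>supp x. x v) = 1}"

definition closed_simplex :: "'v set set \<Rightarrow> 'v set \<Rightarrow> ('v \<Rightarrow> real) set" where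
  "closed_simplex K s = {x \<in> realization_points K. supp x \<subseteq> s}"

text \<open>The realization carries the weak topology: a set is open iff its trace on every closed simplex
  is open there. The topology of a closed simplex is that of pointwise convergence, which on the
  finitely many coordinates in \<open>s\<close> is the Euclidean one. For finite complexes the weak topology is
  just the subspace topology of the Euclidean space of barycentric coordinates, see
  \<open>geometric_realization_finite\<close> below.\<close>

definition geometric_realization :: "'v set set \<Rightarrow> ('v \<Rightarrow> real) topology" where
  "geometric_realization K = topology (\<lambda>U. U \<subseteq> realization_points K \<and>
     (\<forall>s\<in>K. openin (top_of_set (closed_simplex K s)) (U \<inter> closed_simplex K s)))"

lemma openin_geometric_realization:
  "openin (geometric_realization K) U \<longleftrightarrow> U \<subseteq> realization_points K \<and>
     (\<forall>s\<in>K. openin (top_of_set (closed_simplex K s)) (U \<inter> closed_simplex K s))"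
proof -
  have "istopology (\<lambda>U. U \<subseteq> realization_points K \<and>
     (\<forall>s\<in>K. openin (top_of_set (closed_simplex K s)) (U \<inter> closed_simplex K s)))"
    (is "istopology ?P")
    unfolding istopology_def
  proof (intro conjI allI impI)
    fix S T assume ST: "?P S" "?P T"
    then show "S \<inter> T \<subseteq> realization_points K" by blast
    show "\<forall>s\<in>K. openin (top_of_set (closed_simplex K s)) (S \<inter> T \<inter> closed_simplex K s)"
    proof
      fix s assume "s \<in> K"
      then have "openin (top_of_set (closed_simplex K s))
          ((S \<inter> closed_simplex K s) \<inter> (T \<inter> closed_simplex K s))"
        using ST by (blast intro: openin_Int)
      moreover have "(S \<inter> closed_simplex K s) \<inter> (T \<inter> closed_simplex K s)
          = S \<inter> T \<inter> closed_simplex K s" by blast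
      ultimately show "openin (top_of_set (closed_simplex K s)) (S \<inter> T \<inter> closed_simplex K s)"
        by simp
    qed
  next
    fix \<K> assume K: "\<forall>S\<in>\<K>. ?P S"
    then show "\<Union>\<K> \<subseteq> realization_points K" by blast
    show "\<forall>s\<in>K. openin (top_of_set (closed_simplex K s)) (\<Union>\<K> \<inter> closed_simplex K s)"
    proof
      fix s assume "s \<in> K"
      then have "openin (top_of_set (closed_simplex K s)) (\<Union>S\<in>\<K>. S \<inter> closed_simplex K s)"
        using K by (intro openin_Union) auto
      moreover have "(\<Union>S\<in>\<K>. S \<inter> closed_simplex K s) = \<Union>\<K> \<inter> closed_simplex K s" by blast
      ultimately show "openin (top_of_set (closed_simplex K s)) (\<Union>\<K> \<inter> closed_simplex K s)"
        by simp
    qed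
  qed
  then show ?thesis
    unfolding geometric_realization_def by (simp add: topology_inverse')
qed

lemma topspace_geometric_realization:
  "topspace (geometric_realization K) = realization_points K"
proof -
  have "realization_points K \<inter> closed_simplex K s = closed_simplex K s" for s
    unfolding closed_simplex_def by blast
  then have "openin (geometric_realization K) (realization_points K)"
    by (simp add: openin_geometric_realization)
  then show ?thesis
    using openin_subset[of "geometric_realization K" "realization_points K"]
      openin_geometric_realization[of K "topspace (geometric_realization K)"]
    by auto
qed

lemma closedin_closed_simplex:
  "closedin (top_of_set (realization_points K)) (closed_simplex K s)"
proof -
  have "closed_simplex K s = realization_points K \<inter> (\<Inter>v\<in>-s. {x. x v = 0})"
    unfolding closed_simplex_def supp_def by auto
  moreover have "closed (\<Inter>v\<in>-s. {x::'a \<Rightarrow> real. x v = 0})"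
    by (intro closed_INT ballI closed_Collect_eq continuous_intros continuous_on_product_coordinates)
  ultimately show ?thesis
    using closedin_closed_Int by auto
qed

lemma geometric_realization_finite:
  assumes "finite K"
  shows "geometric_realization K = top_of_set (realization_points K)"
proof (rule topology_eq[THEN iffD2], rule allI)
  fix U
  show "openin (geometric_realization K) U \<longleftrightarrow> openin (top_of_set (realization_points K)) U"
  proof
    assume U: "openin (top_of_set (realization_points K)) U"
    have "openin (top_of_set (closed_simplex K s)) (U \<inter> closed_simplex K s)" for s
    proof -
      obtain T where "open T" "U = realization_points K \<inter> T"
        using U by (auto simp: openin_open)
      then show ?thesis
        unfolding openin_open closed_simplex_def by (intro exI[of _ T]) auto
    qed
    moreover have "U \<subseteq> realization_points K"
      using openin_imp_subset U by blast
    ultimately show "openin (geometric_realization K) U"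
      by (simp add: openin_geometric_realization)
  next
    let ?R = "realization_points K"
    assume "openin (geometric_realization K) U"
    then have sub: "U \<subseteq> ?R"
      and op: "\<And>s. s \<in> K \<Longrightarrow> openin (top_of_set (closed_simplex K s)) (U \<inter> closed_simplex K s)"
      by (auto simp: openin_geometric_realization)
    have "closedin (top_of_set ?R) (closed_simplex K s - U)" if "s \<in> K" for s
    proof -
      have "closedin (top_of_set (closed_simplex K s))
          (closed_simplex K s - U \<inter> closed_simplex K s)"
        using op[OF that] by (metis closedin_diff closedin_topspace topspace_euclidean_subtopology)
      then have "closedin (top_of_set (closed_simplex K s)) (closed_simplex K s - U)"
        by (simp add: Diff_Int)
      then show ?thesis
        using closedin_closed_simplex closedin_trans by blast
    qed
    then have "closedin (top_of_set ?R) (\<Union>s\<in>K. closed_simplex K s - U)"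
      using assms by (intro closedin_Union) auto
    moreover have "(\<Union>s\<in>K. closed_simplex K s - U) = ?R - U"
      unfolding closed_simplex_def realization_points_def by auto
    ultimately show "openin (top_of_set ?R) U"
      using sub by (simp add: openin_closedin_eq)
  qed
qed


section \<open>The two complexes\<close>

definition order_complex :: "'a::order set \<Rightarrow> 'a set set" where
  "order_complex P = {C. C \<subseteq> P \<and> finite C \<and> C \<noteq> {} \<and> Complete_Partial_Order.chain (\<le>) C}"

definition proper_subgroups :: "('a, 'b) monoid_scheme \<Rightarrow> 'a set set" where
  "proper_subgroups G = {H. subgroup H G \<and> H \<noteq> carrier G}"

definition proper_nontrivial_subgroups :: "('a, 'b) monoid_scheme \<Rightarrow> 'a set set" where
  "proper_nontrivial_subgroups G = {H \<in> proper_subgroups G. H \<noteq> {\<one>\<^bsub>G\<^esub>}}"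

text \<open>The members of a face are automatically non-trivial, since their intersection is.\<close>

definition intersection_complex :: "('a, 'b) monoid_scheme \<Rightarrow> 'a set set set" where
  "intersection_complex G =
     {F. F \<subseteq> proper_subgroups G \<and> finite F \<and> F \<noteq> {} \<and> \<Inter>F \<noteq> {\<one>\<^bsub>G\<^esub>}}"

lemma simplicial_complex_order_complex: "abstract_simplicial_complex (order_complex P)"
proof -
  have "t \<in> order_complex P" if "s \<in> order_complex P" "t \<subseteq> s" "t \<noteq> {}" for s t
  proof -
    have "finite t"
      using that finite_subset unfolding order_complex_def by blast
    moreover have "Complete_Partial_Order.chain (\<le>) t"
      using that unfolding order_complex_def Complete_Partial_Order.chain_def by blast
    ultimately show ?thesis
      using that unfolding order_complex_def by blast
  qed
  moreover have "finite s \<and> s \<noteq> {}" if "s \<in> order_complex P" for s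
    using that unfolding order_complex_def by blast
  ultimately show ?thesis
    unfolding abstract_simplicial_complex_def by blast
qed

lemma simplicial_complex_intersection_complex:
  assumes "group G"
  shows "abstract_simplicial_complex (intersection_complex G)"
proof -
  have "t \<in> intersection_complex G"
    if s: "s \<in> intersection_complex G" and "t \<subseteq> s" "t \<noteq> {}" for s t
  proof -
    have sub: "s \<subseteq> proper_subgroups G" "finite s" "\<Inter>s \<noteq> {\<one>\<^bsub>G\<^esub>}"
      using s unfolding intersection_complex_def by blast+
    have "\<one>\<^bsub>G\<^esub> \<in> \<Inter>s"
      using sub(1) subgroup.one_closed unfolding proper_subgroups_def by fast
    moreover have "\<Inter>s \<subseteq> \<Inter>t"
      using that(2) by (rule Inter_anti_mono)
    ultimately have "\<Inter>t \<noteq> {\<one>\<^bsub>G\<^esub>}"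
      using sub(3) by blast
    moreover have "finite t"
      using sub(2) that(2) by (rule finite_subset[rotated])
    ultimately show ?thesis
      using that(2,3) sub(1) unfolding intersection_complex_def by blast
  qed
  moreover have "finite s \<and> s \<noteq> {}" if "s \<in> intersection_complex G" for s
    using that unfolding intersection_complex_def by blast
  ultimately show ?thesis
    unfolding abstract_simplicial_complex_def by blast
qed

lemma vertices_intersection_complex:
  "{H. {H} \<in> intersection_complex G} = proper_nontrivial_subgroups G"
  unfolding intersection_complex_def proper_nontrivial_subgroups_def by simp

end

theory Submission
  imports Defs
begin

text \<open>
  Let \<open>P\<close> be the poset of proper non-trivial subgroups. A non-empty finite chain in \<open>P\<close> contains its own
  intersection, so the order complex is a subcomplex of the intersection complex; the inclusion
  of realizations is one half of the equivalence.

  In the other direction, a face \<open>F\<close> of the intersection complex is sent to the subgroup \<open>\<Inter>F\<close>, which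
  again lies in \<open>P\<close>. This assignment reverses inclusions, so it is simplicial from the barycentric
  subdivision of the intersection complex to the order complex. The subdivision need not be built:
  a point \<open>x\<close> with barycentric coordinates \<open>x v\<close> lies in the simplex of the subdivision that is
  spanned by the \<^emph>\<open>level sets\<close> of \<open>x\<close>, the non-empty sets \<open>{v. x v > c}\<close> with \<open>c \<ge> 0\<close>. They form a chain, and
  giving each of them a weight that depends continuously on \<open>x\<close> and vanishes when the set ceases to
  be a level set yields a continuous map of realizations (\<open>continuous_map_from_level_sets\<close>).

  Both composites are homotopic to the identity along straight lines
  (\<open>homotopic_if_supports_span_face\<close>). The support of the image of \<open>x\<close> consists of intersections of
  non-empty subfamilies of the support of \<open>x\<close>. Adding such intersections to a face of the intersection complex
  does not change its total intersection, and adding them to a chain adds nothing at all.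
\<close>

section \<open>Finite realizations and straight-line homotopies\<close>

lemma realization_pointsI:
  assumes "\<And>v. 0 \<le> x v" and "supp x \<in> K" and "finite A" and "supp x \<subseteq> A" and "sum x A = 1"
  shows "x \<in> realization_points K"
proof -
  have "sum x A = sum x (supp x)"
    by (rule sum.mono_neutral_right[OF assms(3,4)]) (auto simp: supp_def)
  with assms show ?thesis
    by (simp add: realization_points_def)
qed

lemma realization_points_mono: "K \<subseteq> L \<Longrightarrow> realization_points K \<subseteq> realization_points L"
  unfolding realization_points_def by blast

text \<open>For each \<open>x\<close> the points \<open>f x\<close> and \<open>g x\<close> lie in a common closed simplex, which is convex, so the
  segment between them stays in the realization. This is the usual argument that contiguous
  simplicial maps are homotopic.\<close>

lemma homotopic_if_supports_span_face:
  fixes f g :: "('u \<Rightarrow> real) \<Rightarrow> 'v \<Rightarrow> real"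
  assumes L: "abstract_simplicial_complex L"
    and f: "continuous_on S f" "f ` S \<subseteq> realization_points L"
    and g: "continuous_on S g" "g ` S \<subseteq> realization_points L"
    and union: "\<And>x. x \<in> S \<Longrightarrow> supp (f x) \<union> supp (g x) \<in> L"
  shows "homotopic_with (\<lambda>_. True) (top_of_set S) (top_of_set (realization_points L)) f g"
proof -
  define h where "h = (\<lambda>(t, x) v. (1 - t) * f x v + t * g x v)"
  have h_cont: "continuous_on ({0..1} \<times> S) h"
  proof (rule continuous_on_coordinatewise_then_product)
    fix v
    have "continuous_on ({0..1::real} \<times> S) (\<lambda>p. f (snd p) v)"
      by (rule continuous_on_compose2[OF continuous_on_product_then_coordinatewise[OF f(1)] continuous_on_snd])
        (auto intro: continuous_on_id)
    moreover have "continuous_on ({0..1::real} \<times> S) (\<lambda>p. g (snd p) v)"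
      by (rule continuous_on_compose2[OF continuous_on_product_then_coordinatewise[OF g(1)] continuous_on_snd])
        (auto intro: continuous_on_id)
    ultimately show "continuous_on ({0..1} \<times> S) (\<lambda>p. h p v)"
      unfolding h_def case_prod_unfold by (intro continuous_intros)
  qed
  have h_points: "h (t, x) \<in> realization_points L" if t: "t \<in> {0..1}" and x: "x \<in> S" for t x
  proof -
    have fx: "f x \<in> realization_points L" and gx: "g x \<in> realization_points L"
      using f(2) g(2) x by auto
    let ?A = "supp (f x) \<union> supp (g x)"
    have nonneg: "0 \<le> f x v" "0 \<le> g x v" for v
      using fx gx by (auto simp: realization_points_def)
    have fin: "finite ?A"
      using L union[OF x] by (auto simp: abstract_simplicial_complex_def)
    have "sum (f x) ?A = sum (f x) (supp (f x))"
      by (rule sum.mono_neutral_right) (use fin in \<open>auto simp: supp_def\<close>)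
    moreover have "sum (g x) ?A = sum (g x) (supp (g x))"
      by (rule sum.mono_neutral_right) (use fin in \<open>auto simp: supp_def\<close>)
    ultimately have sums: "sum (f x) ?A = 1" "sum (g x) ?A = 1"
      using fx gx by (auto simp: realization_points_def)
    have total: "sum (h (t, x)) ?A = 1"
      by (simp add: h_def sum.distrib sum_distrib_left[symmetric] sums)
    have sub: "supp (h (t, x)) \<subseteq> ?A"
      by (auto simp: supp_def h_def)
    have "supp (h (t, x)) \<noteq> {}"
    proof
      assume "supp (h (t, x)) = {}"
      then have "sum (h (t, x)) ?A = 0"
        by (intro sum.neutral) (auto simp: supp_def)
      with total show False by simp
    qed
    then have "supp (h (t, x)) \<in> L"
      using L union[OF x] sub unfolding abstract_simplicial_complex_def by blast
    moreover have "0 \<le> h (t, x) v" for v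
      using t nonneg by (simp add: h_def)
    ultimately show ?thesis
      using fin sub total by (intro realization_pointsI)
  qed
  have "continuous_map (prod_topology (top_of_set {0..1}) (top_of_set S))
      (top_of_set (realization_points L)) h"
    using h_cont h_points by (auto simp: image_subset_iff)
  moreover have "h (0, x) = f x" "h (1, x) = g x" for x
    by (auto simp: h_def)
  ultimately show ?thesis
    unfolding homotopic_with_def by blast
qed

section \<open>Maps defined on level sets\<close>

text \<open>For \<open>x \<ge> 0\<close> supported in a finite set \<open>P\<close> and non-empty \<open>F \<subseteq> P\<close>, this is positive exactly if every coordinate in \<open>F\<close> is positive
  and strictly exceeds every coordinate outside \<open>F\<close>, that is, if \<open>F\<close> is a level set of \<open>x\<close>.
  Products of truncated differences keep it visibly continuous in \<open>x\<close>.\<close>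

definition level_weight :: "'v set \<Rightarrow> ('v \<Rightarrow> real) \<Rightarrow> 'v set \<Rightarrow> real" where
  "level_weight P x F = (\<Prod>v\<in>F. x v * (\<Prod>u\<in>P - F. max 0 (x v - x u)))"

lemma continuous_on_level_weight: "continuous_on S (\<lambda>x. level_weight P x F)"
  unfolding level_weight_def
  by (intro continuous_intros continuous_on_subset[OF continuous_on_product_coordinates]) auto

lemma level_weight_nonneg:
  assumes "\<And>v. 0 \<le> x v"
  shows "0 \<le> level_weight P x F"
  unfolding level_weight_def by (intro prod_nonneg mult_nonneg_nonneg ballI assms) simp

lemma level_weight_nonzeroD:
  assumes "level_weight P x F \<noteq> 0" and "finite P" and "F \<subseteq> P" and "v \<in> F"
  shows "x v \<noteq> 0" and "\<And>u. u \<in> P \<Longrightarrow> u \<notin> F \<Longrightarrow> x u < x v"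
proof -
  have "finite F" using assms(2,3) finite_subset by blast
  then have *: "x v * (\<Prod>u\<in>P - F. max 0 (x v - x u)) \<noteq> 0"
    using assms(1,4) by (auto simp: level_weight_def)
  then show "x v \<noteq> 0" by auto
  fix u assume "u \<in> P" "u \<notin> F"
  with * \<open>finite P\<close> have "max 0 (x v - x u) \<noteq> 0" by auto
  then show "x u < x v" by auto
qed

lemma level_weight_supp_pos:
  assumes "\<And>v. 0 \<le> x v"
  shows "0 < level_weight P x (supp x)"
  unfolding level_weight_def
proof (intro prod_pos mult_pos_pos ballI)
  fix v assume "v \<in> supp x"
  then show v: "0 < x v"
    using assms[of v] by (auto simp: supp_def)
  fix u assume "u \<in> P - supp x"
  then show "0 < max 0 (x v - x u)"
    using v by (auto simp: supp_def)
qed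

text \<open>A vertex \<open>v\<close> in \<open>E\<close> but not in \<open>F\<close> and a vertex \<open>u\<close> in \<open>F\<close> but not in \<open>E\<close> would satisfy both
  \<open>x u < x v\<close> and \<open>x v < x u\<close>.\<close>

lemma level_sets_nested:
  assumes "level_weight P x E \<noteq> 0" "level_weight P x F \<noteq> 0" "finite P" "E \<subseteq> P" "F \<subseteq> P"
  shows "E \<subseteq> F \<or> F \<subseteq> E"
proof (rule ccontr)
  assume "\<not> (E \<subseteq> F \<or> F \<subseteq> E)"
  then obtain v u where "v \<in> E" "v \<notin> F" "u \<in> F" "u \<notin> E" by blast
  then have "x u < x v" "x v < x u"
    using level_weight_nonzeroD(2)[OF assms(1,3,4), of v u]
      level_weight_nonzeroD(2)[OF assms(2,3,5), of u v] assms(4,5) by (simp_all add: subsetD)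
  then show False by simp
qed

text \<open>The map sends \<open>x\<close> to the convex combination of the vertices \<open>\<mu> F\<close>, where \<open>F\<close> runs over the level
  sets of \<open>x\<close>, with the normalized level weights as coefficients. The total weight is positive
  because the support of \<open>x\<close> is a level set. As the level sets of \<open>x\<close> form a chain of faces, it is
  enough that \<open>\<mu>\<close> takes chains of faces of \<open>K\<close> to faces of \<open>L\<close>.\<close>

lemma continuous_map_from_level_sets:
  fixes K :: "'v set set" and L :: "'w set set" and \<mu> :: "'v set \<Rightarrow> 'w"
  assumes K: "abstract_simplicial_complex K" and P: "finite P" "K \<subseteq> Pow P"
    and \<mu>: "\<And>C. C \<subseteq> K \<Longrightarrow> C \<noteq> {} \<Longrightarrow> Complete_Partial_Order.chain (\<subseteq>) C \<Longrightarrow> \<mu> ` C \<in> L"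
  obtains f where "continuous_on (realization_points K) f"
    and "f ` realization_points K \<subseteq> realization_points L"
    and "\<And>x. x \<in> realization_points K \<Longrightarrow> supp (f x) \<subseteq> \<mu> ` {E. E \<subseteq> supp x \<and> E \<noteq> {}}"
proof -
  define total where "total x = (\<Sum>F\<in>K. level_weight P x F)" for x
  define f where "f x w = (\<Sum>F\<in>{F\<in>K. \<mu> F = w}. level_weight P x F) / total x" for x w
  have finK: "finite K"
    using P finite_subset by blast
  have pos: "0 < total x" and nonneg: "\<And>F. 0 \<le> level_weight P x F"
    if "x \<in> realization_points K" for x
  proof -
    from that have x: "\<And>v. 0 \<le> x v" "supp x \<in> K"
      by (auto simp: realization_points_def)
    show nonneg: "0 \<le> level_weight P x F" for F
      using x(1) by (rule level_weight_nonneg)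
    show "0 < total x"
      unfolding total_def using finK x(2) level_weight_supp_pos[of x P, OF x(1)] nonneg
      by (intro sum_pos2)
  qed
  have cont: "continuous_on (realization_points K) f"
  proof (rule continuous_on_coordinatewise_then_product)
    fix w
    show "continuous_on (realization_points K) (\<lambda>x. f x w)"
      unfolding f_def total_def
      by (intro continuous_intros continuous_on_level_weight)
        (use pos in \<open>force simp: total_def\<close>)
  qed
  have supp_f: "supp (f x) = \<mu> ` {F\<in>K. level_weight P x F \<noteq> 0}"
    if x: "x \<in> realization_points K" for x
  proof -
    have "f x w \<noteq> 0 \<longleftrightarrow> (\<exists>F\<in>{F\<in>K. \<mu> F = w}. level_weight P x F \<noteq> 0)" for w
      using pos[OF x] finK nonneg[OF x] by (simp add: f_def sum_nonneg_eq_0_iff)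
    then show ?thesis
      by (auto simp: supp_def)
  qed
  have "f x \<in> realization_points L" if x: "x \<in> realization_points K" for x
  proof (rule realization_pointsI)
    show "0 \<le> f x w" for w
      unfolding f_def using pos[OF x] nonneg[OF x] by (intro divide_nonneg_pos sum_nonneg)
    let ?C = "{F\<in>K. level_weight P x F \<noteq> 0}"
    have "Complete_Partial_Order.chain (\<subseteq>) ?C"
      unfolding Complete_Partial_Order.chain_def
      using level_sets_nested[of P x] P by blast
    moreover have "supp x \<in> ?C"
      using x level_weight_supp_pos[of x P] by (force simp: realization_points_def)
    ultimately have "\<mu> ` ?C \<in> L"
      by (intro \<mu>) auto
    then show "supp (f x) \<in> L"
      by (simp add: supp_f[OF x])
    show "finite (\<mu> ` K)"
      using finK by simp
    show "supp (f x) \<subseteq> \<mu> ` K"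
      by (auto simp: supp_f[OF x])
    have "(\<Sum>w\<in>\<mu> ` K. \<Sum>F\<in>{F\<in>K. \<mu> F = w}. level_weight P x F) = total x"
      unfolding total_def using finK by (intro sum.group) auto
    then show "sum (f x) (\<mu> ` K) = 1"
      using pos[OF x] by (simp add: f_def sum_divide_distrib[symmetric])
  qed
  moreover have "supp (f x) \<subseteq> \<mu> ` {E. E \<subseteq> supp x \<and> E \<noteq> {}}" if x: "x \<in> realization_points K" for x
  proof -
    have "F \<subseteq> supp x \<and> F \<noteq> {}" if "F \<in> K" "level_weight P x F \<noteq> 0" for F
      using level_weight_nonzeroD(1)[OF that(2) P(1)] that(1) P(2) K
      by (auto simp: supp_def abstract_simplicial_complex_def)
    then show ?thesis
      by (auto simp: supp_f[OF x])
  qed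
  ultimately show ?thesis
    using that cont by blast
qed

section \<open>Families of sets and their intersections\<close>

lemma Inter_mem_chain:
  assumes "Complete_Partial_Order.chain (\<subseteq>) C" and "finite C" and "C \<noteq> {}"
  shows "\<Inter>C \<in> C"
  using assms(2,3,1)
proof (induction C rule: finite_ne_induct)
  case (insert X C)
  then have "\<Inter>C \<in> C"
    by (auto simp: Complete_Partial_Order.chain_def)
  with insert.prems have "X \<subseteq> \<Inter>C \<or> \<Inter>C \<subseteq> X"
    by (auto simp: Complete_Partial_Order.chain_def)
  then have "\<Inter>(insert X C) = X \<or> \<Inter>(insert X C) = \<Inter>C"
    by auto
  with \<open>\<Inter>C \<in> C\<close> show ?case by auto
qed simp

text \<open>That \<open>K\<close> is a simplicial complex means here that the intersections of the non-empty
  subfamilies of a face all stay in \<open>P\<close>. Hence every level set \<open>E\<close> of a point of the realization has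
  a vertex \<open>\<Inter>E\<close> of the order complex attached to it, and since \<open>E \<mapsto> \<Inter>E\<close> reverses inclusions, the
  vertices attached to the level sets of one point form a chain.\<close>

lemma intersection_faces_homotopy_equivalent_order_complex:
  fixes P :: "'a set set"
  defines "K \<equiv> {F. F \<subseteq> P \<and> F \<noteq> {} \<and> \<Inter>F \<in> P}"
  assumes P: "finite P" and K: "abstract_simplicial_complex K"
  shows "geometric_realization K homotopy_equivalent_space geometric_realization (order_complex P)"
proof -
  let ?L = "order_complex P"
  have L: "abstract_simplicial_complex ?L"
    by (rule simplicial_complex_order_complex)
  have K_sub: "K \<subseteq> Pow P" and L_sub: "?L \<subseteq> Pow P"
    by (auto simp: K_def order_complex_def)
  have fin: "finite K" "finite ?L"
    using P finite_subset[OF K_sub] finite_subset[OF L_sub] by simp_all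
  have "?L \<subseteq> K"
    using Inter_mem_chain by (auto simp: order_complex_def K_def)
  then have incl: "realization_points ?L \<subseteq> realization_points K"
    by (rule realization_points_mono)
  have Inter_face: "Inter ` C \<in> ?L" if "C \<subseteq> K" "C \<noteq> {}" "Complete_Partial_Order.chain (\<subseteq>) C" for C
  proof -
    have "Complete_Partial_Order.chain (\<subseteq>) (Inter ` C)"
      using that(3) unfolding Complete_Partial_Order.chain_def by (blast dest: Inter_anti_mono)
    moreover have "finite C"
      using that(1) fin(1) finite_subset by blast
    moreover have "Inter ` C \<subseteq> P"
      using that(1) by (auto simp: K_def)
    ultimately show ?thesis
      using that(2) by (simp add: order_complex_def)
  qed
  obtain f where f: "continuous_on (realization_points K) f"
      "f ` realization_points K \<subseteq> realization_points ?L"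
      and supp_f: "\<And>x. x \<in> realization_points K \<Longrightarrow> supp (f x) \<subseteq> Inter ` {E. E \<subseteq> supp x \<and> E \<noteq> {}}"
    by (rule continuous_map_from_level_sets[where \<mu> = Inter, OF K P K_sub],
        erule (2) Inter_face, rule that)

  \<comment> \<open>Every vertex of \<open>f x\<close> contains the total intersection of the support of \<open>x\<close>, so adding these
    vertices to that support leaves the intersection unchanged.\<close>
  have "supp (f x) \<union> supp x \<in> K" if x: "x \<in> realization_points K" for x
  proof -
    have S: "supp x \<in> K"
      using x by (simp add: realization_points_def)
    have "supp (f x) \<in> ?L"
      using f(2) x by (auto simp: realization_points_def)
    then have sub: "supp (f x) \<subseteq> P"
      using L_sub by blast
    have "\<Inter>(supp x) \<subseteq> H" if "H \<in> supp (f x)" for H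
      using supp_f[OF x] that by blast
    then have "\<Inter>(supp (f x) \<union> supp x) = \<Inter>(supp x)"
      by auto
    with S sub show ?thesis
      by (auto simp: K_def)
  qed
  then have homK: "homotopic_with (\<lambda>_. True) (top_of_set (realization_points K))
      (top_of_set (realization_points K)) f (\<lambda>x. x)"
    using f incl by (intro homotopic_if_supports_span_face K) auto

  \<comment> \<open>On a chain, every non-empty subfamily attains its intersection, so \<open>f\<close> does not enlarge
    supports.\<close>
  have "supp (f x) \<union> supp x \<in> ?L" if x: "x \<in> realization_points ?L" for x
  proof -
    have S: "supp x \<in> ?L"
      using x by (simp add: realization_points_def)
    have "\<Inter>E \<in> supp x" if "E \<subseteq> supp x" "E \<noteq> {}" for E
    proof -
      have "E \<in> ?L"
        using L S that unfolding abstract_simplicial_complex_def by blast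
      then show ?thesis
        using Inter_mem_chain[of E] that(1) by (auto simp: order_complex_def)
    qed
    then have "supp (f x) \<subseteq> supp x"
      using supp_f[of x] x incl by blast
    with S show ?thesis
      by (simp add: Un_absorb1)
  qed
  then have homL: "homotopic_with (\<lambda>_. True) (top_of_set (realization_points ?L))
      (top_of_set (realization_points ?L)) f (\<lambda>x. x)"
    using f incl
    by (intro homotopic_if_supports_span_face L) (auto intro: continuous_on_subset)

  have "continuous_map (top_of_set (realization_points K)) (top_of_set (realization_points ?L)) f"
    using f by auto
  moreover have "continuous_map (top_of_set (realization_points ?L))
      (top_of_set (realization_points K)) (\<lambda>x. x)"
    using incl by auto
  ultimately show ?thesis
    unfolding geometric_realization_finite[OF fin(1)] geometric_realization_finite[OF fin(2)]
      homotopy_equivalent_space_def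
    using homK homL by (intro exI[of _ f] exI[of _ "\<lambda>x. x"]) (simp add: o_def id_def)
qed

section \<open>Subgroups\<close>

text \<open>Subgroups are closed under intersection, so a non-trivial intersection of proper subgroups is
  itself a vertex.\<close>

lemma intersection_complex_eq:
  assumes "group G" and "finite (carrier G)"
  shows "intersection_complex G =
    {F. F \<subseteq> proper_nontrivial_subgroups G \<and> F \<noteq> {} \<and> \<Inter>F \<in> proper_nontrivial_subgroups G}"
proof (intro subset_antisym subsetI CollectI)
  fix F assume F: "F \<in> intersection_complex G"
  then have face: "F \<subseteq> proper_subgroups G" "F \<noteq> {}" "\<Inter>F \<noteq> {\<one>\<^bsub>G\<^esub>}"
    by (auto simp: intersection_complex_def)
  have "{H} \<in> intersection_complex G" if "H \<in> F" for H
    using simplicial_complex_intersection_complex[OF assms(1)] F that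
    by (simp add: abstract_simplicial_complex_def)
  then have "F \<subseteq> proper_nontrivial_subgroups G"
    by (auto simp: vertices_intersection_complex[symmetric])
  moreover have "subgroup (\<Inter>F) G"
    using face by (intro group.subgroups_Inter[OF assms(1)]) (auto simp: proper_subgroups_def)
  moreover have "\<Inter>F \<noteq> carrier G"
  proof -
    obtain H where "H \<in> F" using face(2) by blast
    then have "H \<subseteq> carrier G" "H \<noteq> carrier G"
      using face(1) subgroup.subset by (auto simp: proper_subgroups_def)
    with \<open>H \<in> F\<close> show ?thesis by blast
  qed
  ultimately show "F \<subseteq> proper_nontrivial_subgroups G \<and> F \<noteq> {} \<and>
      \<Inter>F \<in> proper_nontrivial_subgroups G"
    using face by (simp add: proper_nontrivial_subgroups_def proper_subgroups_def)
next
  fix F assume F: "F \<in> {F. F \<subseteq> proper_nontrivial_subgroups G \<and> F \<noteq> {} \<and>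
      \<Inter>F \<in> proper_nontrivial_subgroups G}"
  then have "F \<subseteq> Pow (carrier G)"
    using subgroup.subset by (fastforce simp: proper_nontrivial_subgroups_def proper_subgroups_def)
  then have "finite F"
    using assms(2) finite_subset by blast
  with F show "F \<in> intersection_complex G"
    by (auto simp: intersection_complex_def proper_nontrivial_subgroups_def)
qed

theorem proposition7p2:
  fixes G :: "('a, 'b) monoid_scheme"
  assumes "group G" and "finite (carrier G)"
  shows "geometric_realization (intersection_complex G)
           homotopy_equivalent_space
         geometric_realization (order_complex (proper_nontrivial_subgroups G))"
proof -
  have "proper_nontrivial_subgroups G \<subseteq> Pow (carrier G)"
    using subgroup.subset by (auto simp: proper_nontrivial_subgroups_def proper_subgroups_def)
  then have "finite (proper_nontrivial_subgroups G)"
    using assms(2) finite_subset by blast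
  then show ?thesis
    using simplicial_complex_intersection_complex[OF assms(1)]
    unfolding intersection_complex_eq[OF assms]
    by (rule intersection_faces_homotopy_equivalent_order_complex)
qed

end
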